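(* Let $H_n$ be a graph on $n$ vertices with $\delta(H_n)\geq n/2-\eta$, where $1/2\leq\eta=\eta(n)\leq n/64$. (a) If $m=\omega(\eta)$, then a.a.s. $H_n\cup G_{n,m}$ is Hamiltonian. (b) If $\eta=\omega(1)$, $\lambda=\lambda(n)=\omega(\eta^{1/2})$ and $m\geq\frac{2\eta}{1/4-8\eta/n}+\lambda$, then a.a.s. $H_n\cup G_{n,m}$ is Hamiltonian.
   Context: All graphs are simple; $H_n$ denotes a sequence of graphs indexed by $n$. For an integer $m\in[\binom{n}{2}]$, $G_{n,m}$ is the random graph on the same $n$-vertex set as $H_n$ having exactly $m$ edges, chosen uniformly at random among all such graphs; $H_n\cup G_{n,m}$ is the union of edge sets. A graph is Hamiltonian if it contains a cycle through all its vertices. An event holds asymptotically almost surely (a.a.s.) if its probability tends to $1$ as $n\to\infty$. $\delta(\cdot)$ denotes minimum degree; asymptotic notation is as $n\to\infty$. *)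

theory Defs
  imports "HOL-Probability.Probability" "HOL-Library.Landau_Symbols" "HOL-Library.Ramsey"
begin

text \<open>
  A finite simple graph is given by a finite vertex set and a set of two-element subsets of it.
\<close>

definition simple_graph :: "'a set \<Rightarrow> 'a set set \<Rightarrow> bool" where
  "simple_graph V E \<longleftrightarrow> finite V \<and> E \<subseteq> nsets V 2"

definition vertex_degree :: "'a set set \<Rightarrow> 'a \<Rightarrow> nat" where
  "vertex_degree E v = card {e \<in> E. v \<in> e}"

definition min_degree :: "'a set \<Rightarrow> 'a set set \<Rightarrow> nat" where
  "min_degree V E = Min (vertex_degree E ` V)"

definition graph_cycle :: "'a set set \<Rightarrow> 'a list \<Rightarrow> bool" where
  "graph_cycle E vs \<longleftrightarrow> length vs \<ge> 3 \<and> distinct vs \<and>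
     (\<forall>i < length vs. {vs ! i, vs ! (Suc i mod length vs)} \<in> E)"

definition hamiltonian :: "'a set \<Rightarrow> 'a set set \<Rightarrow> bool" where
  "hamiltonian V E \<longleftrightarrow> (\<exists>vs. graph_cycle E vs \<and> set vs = V)"

text \<open>
  The uniform random graph with exactly \<open>m\<close> edges on the vertex set \<open>V\<close>. As always with
  \<^const>\<open>pmf_of_set\<close>, this is meaningful only if there is such a graph, that is, if
  \<open>V\<close> is finite and \<open>m \<le> card V choose 2\<close>.
\<close>

definition Gnm :: "'a set \<Rightarrow> nat \<Rightarrow> 'a set set pmf" where
  "Gnm V m = pmf_of_set {E. simple_graph V E \<and> card E = m}"

lemma finite_simple_graphs: "finite {E. simple_graph V E \<and> card E = m}"
proof (cases "finite V")
  case True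
  then have "finite (Pow (nsets V 2))"
    by (simp add: finite_imp_finite_nsets)
  then show ?thesis
    by (rule finite_subset[rotated]) (auto simp: simple_graph_def)
qed (simp add: simple_graph_def)

lemma card_simple_graphs:
  assumes "finite V"
  shows "card {E. simple_graph V E \<and> card E = m} = (card V choose 2) choose m"
proof -
  have "{E. simple_graph V E \<and> card E = m} = {E. E \<subseteq> nsets V 2 \<and> card E = m}"
    using assms by (auto simp: simple_graph_def)
  then show ?thesis
    using assms by (simp add: n_subsets finite_imp_finite_nsets card_nsets)
qed

definition asymptotically_almost_surely ::
    "(nat \<Rightarrow> 'b pmf) \<Rightarrow> (nat \<Rightarrow> 'b \<Rightarrow> bool) \<Rightarrow> bool" where
  "asymptotically_almost_surely G P \<longleftrightarrow>
     (\<lambda>n. measure_pmf.prob (G n) {x. P n x}) \<longlonglongrightarrow> 1"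

end

theory Submission
  imports Defs
begin

text \<open>
  Let \<open>d\<close> be the minimum degree of \<open>H\<close>. Expose the random edges one at a time. As long as the
  current graph is not Hamiltonian, at least a fraction \<open>p = 1/4 - 8\<eta>/n\<close> of all pairs are absent
  edges whose addition makes progress:
  \<^item> if the graph is disconnected, the at least \<open>(d + 1)\<^sup>2\<close> pairs across a cut connect it;
  \<^item> if it is connected, a longest path has at least \<open>min n (2d)\<close> vertices, and rotating it at both
    ends yields at least \<open>d\<^sup>2/2\<close> pairs that close up a path on the same vertices to a cycle;
  \<^item> if a longest cycle misses \<open>k + 1 \<le> n - 2d\<close> vertices, one of them being \<open>v\<close>, then any edge joining
    two successors of neighbours of \<open>v\<close> on the cycle gives a cycle that also passes through \<open>v\<close>.
  Hence \<open>K = 2\<eta> + 2\<close> successful edges suffice, and the probability of failure is at most that of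
  fewer than \<open>K\<close> successes in \<open>m\<close> independent trials of probability \<open>p\<close>. The exponential-moment
  bound \<open>exp (- (pm - K)\<^sup>2 / (4pm))\<close> tends to zero in both regimes.
\<close>

section \<open>Paths and cycles\<close>

definition graph_path :: "'a set set \<Rightarrow> 'a list \<Rightarrow> bool" where
  "graph_path E vs \<longleftrightarrow> distinct vs \<and> successively (\<lambda>x y. {x, y} \<in> E) vs"

lemma graph_path_rev [simp]: "graph_path E (rev vs) \<longleftrightarrow> graph_path E vs"
  by (simp add: graph_path_def insert_commute)

lemma graph_path_append:
  "graph_path E (xs @ ys) \<longleftrightarrow> graph_path E xs \<and> graph_path E ys \<and> set xs \<inter> set ys = {} \<and>
     (xs = [] \<or> ys = [] \<or> {last xs, hd ys} \<in> E)"
  by (auto simp: graph_path_def successively_append_iff)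

lemma graph_path_Cons:
  "graph_path E (x # xs) \<longleftrightarrow> x \<notin> set xs \<and> graph_path E xs \<and> (xs = [] \<or> {x, hd xs} \<in> E)"
  by (auto simp: graph_path_def successively_Cons)

lemma graph_path_singleton [simp]: "graph_path E [x]"
  by (simp add: graph_path_def)

text \<open>With the closing edge split off, cycles can be cut and reassembled by the append rules
  for paths instead of modular indices.\<close>

lemma graph_cycle_iff_path:
  "graph_cycle E vs \<longleftrightarrow> length vs \<ge> 3 \<and> graph_path E vs \<and> {last vs, hd vs} \<in> E"
proof (cases "vs = []")
  case False
  have "(\<forall>i<length vs. {vs ! i, vs ! (Suc i mod length vs)} \<in> E) \<longleftrightarrow>
      (\<forall>i. Suc i < length vs \<longrightarrow> {vs ! i, vs ! Suc i} \<in> E) \<and> {last vs, hd vs} \<in> E"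
    (is "?L \<longleftrightarrow> ?R")
  proof
    assume L: ?L
    have "{vs ! i, vs ! Suc i} \<in> E" if "Suc i < length vs" for i
      using L[rule_format, of i] that by simp
    moreover have "{last vs, hd vs} \<in> E"
      using L[rule_format, of "length vs - 1"] False by (simp add: last_conv_nth hd_conv_nth)
    ultimately show ?R by blast
  next
    assume R: ?R
    show ?L
    proof (intro allI impI)
      fix i assume i: "i < length vs"
      show "{vs ! i, vs ! (Suc i mod length vs)} \<in> E"
      proof (cases "Suc i < length vs")
        case True
        then show ?thesis using R by simp
      next
        case neq: False
        then have "Suc i = length vs" using i by simp
        moreover from this have "i = length vs - 1" by simp
        ultimately show ?thesis using R False by (simp add: last_conv_nth hd_conv_nth)
      qed
    qed
  qed
  then show ?thesis
    by (auto simp: graph_cycle_def graph_path_def successively_conv_nth)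
qed (simp add: graph_cycle_def)

lemma graph_cycle_mono: "graph_cycle E vs \<Longrightarrow> E \<subseteq> F \<Longrightarrow> graph_cycle F vs"
  by (auto simp: graph_cycle_def)

lemma graph_path_mono: "graph_path E vs \<Longrightarrow> E \<subseteq> F \<Longrightarrow> graph_path F vs"
  by (auto simp: graph_path_def elim!: successively_mono)

lemma set_graph_cycle_subset:
  assumes "simple_graph V E" "graph_cycle E vs"
  shows "set vs \<subseteq> V"
proof
  fix x assume "x \<in> set vs"
  then obtain i where "i < length vs" "x = vs ! i"
    by (auto simp: in_set_conv_nth)
  then have "{x, vs ! (Suc i mod length vs)} \<in> E"
    using assms(2) by (auto simp: graph_cycle_def)
  then have "{x, vs ! (Suc i mod length vs)} \<in> nsets V 2"
    using assms(1) unfolding simple_graph_def by blast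
  then show "x \<in> V" by simp
qed

section \<open>Neighbourhoods and their successors along a list\<close>

definition neighbours :: "'a set set \<Rightarrow> 'a \<Rightarrow> 'a set" where
  "neighbours E v = {u. {u, v} \<in> E}"

lemma neighbours_subset: "simple_graph V E \<Longrightarrow> neighbours E v \<subseteq> V - {v}"
  unfolding neighbours_def simple_graph_def by (fastforce simp: nsets_def)

lemma finite_neighbours: "simple_graph V E \<Longrightarrow> finite (neighbours E v)"
  by (rule finite_subset[OF neighbours_subset]) (auto simp: simple_graph_def)

lemma vertex_degree_eq_card_neighbours:
  assumes "simple_graph V E"
  shows "vertex_degree E v = card (neighbours E v)"
proof -
  have "{e \<in> E. v \<in> e} = (\<lambda>u. {u, v}) ` neighbours E v"
  proof (intro equalityI subsetI)
    fix e assume e: "e \<in> {e \<in> E. v \<in> e}"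
    then obtain x y where "e = {x, y}" "x \<noteq> y"
      using assms by (auto simp: simple_graph_def elim!: nsets2_E dest!: subsetD)
    then show "e \<in> (\<lambda>u. {u, v}) ` neighbours E v"
      using e by (auto simp: neighbours_def insert_commute)
  qed (auto simp: neighbours_def)
  moreover have "inj_on (\<lambda>u. {u, v}) (neighbours E v)"
    by (auto simp: inj_on_def doubleton_eq_iff)
  ultimately show ?thesis
    by (simp add: vertex_degree_def card_image)
qed

text \<open>Splitting the list rather than indexing it exposes the pieces that the later surgeries
  reverse. The list is read linearly: on a cycle, the wrap-around successor of the last vertex is
  left out.\<close>

definition succs :: "'a set set \<Rightarrow> 'a \<Rightarrow> 'a list \<Rightarrow> 'a set" where
  "succs E v vs = {hd bs | as bs. vs = as @ bs \<and> as \<noteq> [] \<and> bs \<noteq> [] \<and> {last as, v} \<in> E}"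

lemma succs_conv_nth:
  "succs E v vs = (\<lambda>i. vs ! Suc i) ` {i. Suc i < length vs \<and> {vs ! i, v} \<in> E}"
proof (intro equalityI subsetI)
  fix x assume "x \<in> succs E v vs"
  then obtain as bs where *: "x = hd bs" "vs = as @ bs" "as \<noteq> []" "bs \<noteq> []" "{last as, v} \<in> E"
    by (auto simp: succs_def)
  then show "x \<in> (\<lambda>i. vs ! Suc i) ` {i. Suc i < length vs \<and> {vs ! i, v} \<in> E}"
    by (intro image_eqI[of _ _ "length as - 1"])
       (auto simp: nth_append hd_conv_nth last_conv_nth)
next
  fix x assume "x \<in> (\<lambda>i. vs ! Suc i) ` {i. Suc i < length vs \<and> {vs ! i, v} \<in> E}"
  then obtain i where i: "Suc i < length vs" "{vs ! i, v} \<in> E" "x = vs ! Suc i"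
    by auto
  have "vs = take (Suc i) vs @ drop (Suc i) vs" by simp
  moreover have "x = hd (drop (Suc i) vs)"
    "take (Suc i) vs \<noteq> []" "drop (Suc i) vs \<noteq> []" "last (take (Suc i) vs) = vs ! i"
    using i by (auto simp: hd_drop_conv_nth take_Suc_conv_app_nth)
  ultimately show "x \<in> succs E v vs"
    unfolding succs_def using i(2) by (metis (mono_tags, lifting) mem_Collect_eq)
qed

lemma succs_subset_tl: "succs E v vs \<subseteq> set (tl vs)"
  by (auto simp: succs_def)

lemma finite_succs: "finite (succs E v vs)"
  by (rule finite_subset[OF succs_subset_tl]) simp

lemma card_succs:
  assumes "distinct vs"
  shows "card (succs E v vs) = card (neighbours E v \<inter> set (butlast vs))"
proof -
  let ?I = "{i. Suc i < length vs \<and> {vs ! i, v} \<in> E}"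
  have "inj_on (\<lambda>i. vs ! Suc i) ?I" "inj_on (\<lambda>i. vs ! i) ?I"
    using assms by (auto simp: inj_on_def nth_eq_iff_index_eq)
  moreover have "neighbours E v \<inter> set (butlast vs) = (\<lambda>i. vs ! i) ` ?I"
    by (force simp: neighbours_def set_conv_nth nth_butlast image_iff less_diff_conv)
  ultimately show ?thesis
    by (simp add: succs_conv_nth card_image)
qed

text \<open>No vertex is its own neighbour, so leaving out the last vertex of the path, which has no
  successor, loses nothing.\<close>

lemma card_succs_last:
  assumes "simple_graph V E" "graph_path E vs" "vs \<noteq> []" "neighbours E (last vs) \<subseteq> set vs"
  shows "card (succs E (last vs) vs) = card (neighbours E (last vs))"
proof -
  have "set vs = insert (last vs) (set (butlast vs))"
    using append_butlast_last_id[OF assms(3)]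
    by (metis Un_insert_right list.simps(15) set_append sup_bot_right empty_set)
  then have "neighbours E (last vs) \<subseteq> set (butlast vs)"
    using assms(4) neighbours_subset[OF assms(1), of "last vs"] by auto
  then show ?thesis
    using assms(2) by (simp add: card_succs graph_path_def Int_absorb2)
qed

text \<open>Which of \<open>x\<close> and \<open>y\<close> comes first on the list is unknown, so
  the heads of the last two pieces match them only as an unordered pair.\<close>

lemma succs_pairE:
  assumes "x \<in> succs E v vs" "y \<in> succs E v vs" "x \<noteq> y"
  obtains as bs cs where "vs = as @ bs @ cs" "as \<noteq> []" "bs \<noteq> []" "cs \<noteq> []"
    "{last as, v} \<in> E" "{last bs, v} \<in> E" "{x, y} = {hd bs, hd cs}"
proof -
  obtain as bs where 1: "x = hd bs" "vs = as @ bs" "as \<noteq> []" "bs \<noteq> []" "{last as, v} \<in> E"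
    using assms(1) by (auto simp: succs_def)
  obtain cs ds where 2: "y = hd ds" "vs = cs @ ds" "cs \<noteq> []" "ds \<noteq> []" "{last cs, v} \<in> E"
    using assms(2) by (auto simp: succs_def)
  obtain us where "as = cs @ us \<and> us @ bs = ds \<or> as @ us = cs \<and> bs = us @ ds"
    using 1(2) 2(2) by (auto simp: append_eq_append_conv2)
  then show thesis
  proof
    assume us: "as = cs @ us \<and> us @ bs = ds"
    then have "us \<noteq> []" using 1 2 assms(3) by auto
    then show thesis using us 1 2 by (intro that[of cs us bs]) auto
  next
    assume us: "as @ us = cs \<and> bs = us @ ds"
    then have "us \<noteq> []" using 1 2 assms(3) by auto
    then show thesis using us 1 2 by (intro that[of as us ds]) auto
  qed
qed

text \<open>Posa rotation: \<open>as @ rev bs\<close> trades the edge between the two pieces for the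
  one from \<open>last as\<close> to the old end. As \<open>as\<close> is nonempty, the head
  survives.\<close>

lemma graph_path_rotate_end:
  assumes "graph_path E vs" "b \<in> succs E (last vs) vs"
  obtains ws where "graph_path E ws" "set ws = set vs" "hd ws = hd vs" "last ws = b"
proof -
  obtain as bs where *: "b = hd bs" "vs = as @ bs" "as \<noteq> []" "bs \<noteq> []" "{last as, last vs} \<in> E"
    using assms(2) by (auto simp: succs_def)
  show thesis
    using * assms(1) by (intro that[of "as @ rev bs"])
      (auto simp: graph_path_append hd_rev last_rev)
qed

lemma length_graph_path_eq:
  "graph_path E xs \<Longrightarrow> graph_path F ys \<Longrightarrow> set xs = set ys \<Longrightarrow> length xs = length ys"
  by (metis graph_path_def distinct_card)

text \<open>Dirac's crossing chords: the successors of neighbours of the last vertex and the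
  neighbours of the first vertex all lie in \<open>tl vs\<close>, which is too small for the two
  sets to be disjoint. At a common vertex \<open>hd bs\<close>, reversing \<open>as\<close> yields
  the cycle.\<close>

lemma graph_cycle_through_path:
  assumes E: "simple_graph V E" and path: "graph_path E vs" and len: "length vs \<ge> 3"
    and ends: "neighbours E (hd vs) \<subseteq> set vs" "neighbours E (last vs) \<subseteq> set vs"
    and deg: "card (neighbours E (hd vs)) + card (neighbours E (last vs)) \<ge> length vs"
  obtains ws where "graph_cycle E ws" "set ws = set vs"
proof -
  have ne: "vs \<noteq> []" and dist: "distinct vs" using len path by (auto simp: graph_path_def)
  have "card (succs E (last vs) vs) = card (neighbours E (last vs))"
    using card_succs_last[OF E path ne ends(2)] .
  moreover have hd: "neighbours E (hd vs) \<subseteq> set (tl vs)"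
    using ends(1) neighbours_subset[OF E, of "hd vs"] ne by (cases vs) auto
  moreover have "card (set (tl vs)) < length vs"
    using ne dist by (simp add: distinct_card distinct_tl)
  moreover have "card (succs E (last vs) vs \<union> neighbours E (hd vs)) \<le> card (set (tl vs))"
    using hd succs_subset_tl[of E "last vs" vs] by (intro card_mono) auto
  ultimately have "succs E (last vs) vs \<inter> neighbours E (hd vs) \<noteq> {}"
    using deg card_Un_disjoint[of "succs E (last vs) vs" "neighbours E (hd vs)"]
      finite_succs[of E "last vs" vs] finite_neighbours[OF E, of "hd vs"] by linarith
  then obtain as bs where *: "hd bs \<in> neighbours E (hd vs)" "vs = as @ bs" "as \<noteq> []" "bs \<noteq> []"
    "{last as, last vs} \<in> E"
    unfolding succs_def by blast
  show thesis
  proof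
    show "graph_cycle E (rev as @ bs)"
      using * path len unfolding graph_cycle_iff_path
      by (auto simp: graph_path_append neighbours_def insert_commute hd_rev last_rev)
    show "set (rev as @ bs) = set vs" using * by simp
  qed
qed

text \<open>Opened at \<open>x\<close>, the cycle becomes the path \<open>x # bs @ as\<close>, and
  \<open>y\<close> goes in front.\<close>

lemma graph_path_extend_cycle:
  assumes "graph_cycle E vs" "{x, y} \<in> E" "x \<in> set vs" "y \<notin> set vs"
  obtains ws where "graph_path E ws" "length ws = Suc (length vs)" "set ws = insert y (set vs)"
proof -
  obtain as bs where vs: "vs = as @ x # bs"
    using assms(3) by (auto simp: in_set_conv_decomp)
  have "graph_path E as" "graph_path E (x # bs)" "set as \<inter> set (x # bs) = {}"
    using assms(1) by (auto simp: vs graph_cycle_iff_path graph_path_append)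
  moreover have "{last (x # bs), hd as} \<in> E" if "as \<noteq> []"
    using assms(1) that by (auto simp: vs graph_cycle_iff_path)
  ultimately have "graph_path E ((x # bs) @ as)"
    by (auto simp only: graph_path_append)
  then have "graph_path E (y # x # bs @ as)"
    using assms(2,4) by (simp add: graph_path_Cons[of E y] vs insert_commute)
  then show thesis
    by (rule that) (auto simp: vs)
qed

lemma graph_cycle_insert_vertex:
  assumes cyc: "graph_cycle E vs" and v: "v \<notin> set vs"
    and xy: "x \<in> succs E v vs" "y \<in> succs E v vs" "x \<noteq> y"
  obtains ws where "graph_cycle (insert {x, y} E) ws" "length ws = Suc (length vs)"
proof -
  obtain as bs cs where *: "vs = as @ bs @ cs" "as \<noteq> []" "bs \<noteq> []" "cs \<noteq> []"
    "{last as, v} \<in> E" "{last bs, v} \<in> E" "{x, y} = {hd bs, hd cs}"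
    using xy by (rule succs_pairE)
  let ?F = "insert {x, y} E"
  have "graph_cycle ?F vs"
    using cyc by (rule graph_cycle_mono) auto
  moreover have "{hd cs, hd bs} \<in> ?F" "{last as, v} \<in> ?F" "{last bs, v} \<in> ?F"
    using * by (auto simp: insert_commute)
  \<comment> \<open>Here \<open>hd as\<close> meets \<open>last cs\<close> through the old closing
    edge, \<open>hd cs\<close> meets \<open>hd bs\<close> through the new edge, and \<open>v\<close>
    sits between \<open>last bs\<close> and \<open>last as\<close>.\<close>
  ultimately have "graph_cycle ?F (v # rev as @ rev cs @ bs)"
    using * v unfolding graph_cycle_iff_path
    by (auto simp: graph_path_append graph_path_Cons hd_append hd_rev last_rev insert_commute
      simp del: insert_iff)
  then show thesis using * by (intro that) auto
qed

section \<open>Edges that make progress\<close>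

text \<open>Cuts instead of walks: a disconnected graph hands over a separated set whose crossing
  pairs can be counted, a connected one an edge leaving the vertex set of a path.\<close>

definition graph_connected :: "'a set \<Rightarrow> 'a set set \<Rightarrow> bool" where
  "graph_connected V E \<longleftrightarrow>
     (\<forall>S. S \<subseteq> V \<and> S \<noteq> {} \<and> S \<noteq> V \<longrightarrow> (\<exists>x\<in>S. \<exists>y\<in>V - S. {x, y} \<in> E))"

lemma not_graph_connectedE:
  assumes "\<not> graph_connected V E"
  obtains S where "S \<subseteq> V" "S \<noteq> {}" "S \<noteq> V" "\<And>x y. x \<in> S \<Longrightarrow> y \<in> V - S \<Longrightarrow> {x, y} \<notin> E"
  using assms unfolding graph_connected_def by blast

text \<open>A vertex of \<open>S\<close> has all its neighbours in \<open>S\<close>.\<close>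

lemma card_isolated_set:
  assumes E: "simple_graph V E" and deg: "\<forall>v\<in>V. d \<le> card (neighbours E v)"
    and S: "S \<subseteq> V" "S \<noteq> {}" "\<And>x y. x \<in> S \<Longrightarrow> y \<in> V - S \<Longrightarrow> {x, y} \<notin> E"
  shows "d + 1 \<le> card S"
proof -
  obtain v where v: "v \<in> S" using S(2) by auto
  have fin: "finite S" using E S(1) finite_subset by (auto simp: simple_graph_def)
  have "neighbours E v \<subseteq> S - {v}"
    using neighbours_subset[OF E, of v] S(3)[OF v] by (auto simp: neighbours_def insert_commute)
  then have "card (neighbours E v) \<le> card (S - {v})"
    using fin by (intro card_mono) auto
  moreover have "d \<le> card (neighbours E v)" using deg v S(1) by blast
  moreover have "card S > 0" using v fin card_gt_0_iff by blast
  ultimately show ?thesis using v by simp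
qed

text \<open>Both sides of a cut are isolated sets, hence the count of crossing pairs. A single such
  pair connects the graph because fewer than \<open>3 * (d + 1)\<close> vertices leave no room for a
  third component.\<close>

lemma connecting_edges:
  assumes E: "simple_graph V E" and deg: "\<forall>v\<in>V. d \<le> card (neighbours E v)"
    and big: "card V < 3 * (d + 1)" and disconn: "\<not> graph_connected V E"
  obtains B where "B \<subseteq> nsets V 2 - E" "(d + 1)\<^sup>2 \<le> card B"
    "\<And>e. e \<in> B \<Longrightarrow> graph_connected V (insert e E)"
proof -
  have finV: "finite V" using E by (simp add: simple_graph_def)
  obtain S where S: "S \<subseteq> V" "S \<noteq> {}" "S \<noteq> V" "\<And>x y. x \<in> S \<Longrightarrow> y \<in> V - S \<Longrightarrow> {x, y} \<notin> E"
    using disconn by (rule not_graph_connectedE) blast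
  let ?B = "(\<lambda>(x, y). {x, y}) ` (S \<times> (V - S))"
  have inj: "inj_on (\<lambda>(x, y). {x, y}) (S \<times> (V - S))"
    by (auto simp: inj_on_def doubleton_eq_iff)
  have S1: "d + 1 \<le> card S"
    using card_isolated_set[OF E deg S(1,2,4)] .
  have "{x, y} \<notin> E" if "x \<in> V - S" "y \<in> V - (V - S)" for x y
    using S(4)[of y x] that by (auto simp: insert_commute)
  moreover have "V - S \<noteq> {}" using S(1,3) by blast
  ultimately have S2: "d + 1 \<le> card (V - S)"
    using card_isolated_set[OF E deg, of "V - S"] by blast
  have "graph_connected V (insert {x, y} E)" if xy: "x \<in> S" "y \<in> V - S" for x y
  proof (rule ccontr)
    assume "\<not> graph_connected V (insert {x, y} E)"
    then obtain T where T: "T \<subseteq> V" "T \<noteq> {}" "T \<noteq> V"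
      "\<And>u v. u \<in> T \<Longrightarrow> v \<in> V - T \<Longrightarrow> {u, v} \<notin> insert {x, y} E"
      by (rule not_graph_connectedE) blast
    have T': "{u, v} \<notin> E" "{v, u} \<notin> E" "{u, v} \<noteq> {x, y}" "{v, u} \<noteq> {x, y}"
      if "u \<in> T" "v \<in> V - T" for u v
      using T(4)[OF that] by (auto simp: insert_commute)
    have S': "{u, v} \<notin> E" "{v, u} \<notin> E" if "u \<in> S" "v \<in> V - S" for u v
      using S(4)[OF that] by (auto simp: insert_commute)
    \<comment> \<open>The four atoms of the cuts \<open>S\<close> and \<open>T\<close>: vertices in
      different atoms are separated by one of the cuts, so every nonempty atom is isolated in
      \<open>E\<close>.\<close>
    have atom: "W = {} \<or> d + 1 \<le> card W"
      if "W \<in> {S \<inter> T, S - T, T - S, V - (S \<union> T)}" for W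
    proof (cases "W = {}")
      case False
      have "{u, v} \<notin> E" if "u \<in> W" "v \<in> V - W" for u v
      proof (cases "u \<in> S \<longleftrightarrow> v \<in> S")
        case True
        then have "u \<in> T \<longleftrightarrow> v \<notin> T"
          using \<open>W \<in> _\<close> that by auto
        then show ?thesis
          using T'(1)[of u v] T'(2)[of v u] that \<open>W \<in> _\<close> S(1) T(1) by auto
      next
        case False
        then show ?thesis
          using S'(1)[of u v] S'(2)[of v u] that \<open>W \<in> _\<close> S(1) T(1) by auto
      qed
      then show ?thesis
        using card_isolated_set[OF E deg, of W] \<open>W \<in> _\<close> False S(1) T(1) by auto
    qed simp
    have "T \<noteq> S" "T \<noteq> V - S"
      using T'(3)[of x y] T'(4)[of y x] xy S(1) by auto
    have "card V = card S + card (V - S)"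
      using S(1) finV by (simp add: card_Diff_subset finite_subset card_mono)
    moreover have "card S = card (S \<inter> T) + card (S - T)"
      using S(1) finV by (metis card_Int_Diff finite_subset)
    moreover have "card (V - S) = card (T - S) + card (V - (S \<union> T))"
    proof -
      have "(V - S) \<inter> T = T - S" "V - S - T = V - (S \<union> T)" using T(1) by auto
      then show ?thesis using finV by (metis card_Int_Diff finite_Diff)
    qed
    \<comment> \<open>The added edge crosses \<open>S\<close> but not \<open>T\<close>, so
      \<open>T\<close> splits one side of \<open>S\<close>. That side has at least
      \<open>2 * (d + 1)\<close> vertices and the other at least \<open>d + 1\<close>, too many in
      total.\<close>
    moreover have "S \<inter> T \<noteq> {} \<and> S - T \<noteq> {} \<or> T - S \<noteq> {} \<and> V - (S \<union> T) \<noteq> {}"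
      using \<open>T \<noteq> S\<close> \<open>T \<noteq> V - S\<close> S T(1-3) by blast
    ultimately show False
      using atom[of "S \<inter> T"] atom[of "S - T"] atom[of "T - S"] atom[of "V - (S \<union> T)"]
        S1 S2 big by auto
  qed
  moreover have "?B \<subseteq> nsets V 2 - E"
    using S by auto
  moreover have "(d + 1)\<^sup>2 \<le> card ?B"
    using mult_le_mono[OF S1 S2]
    by (simp add: card_image[OF inj] card_cartesian_product power2_eq_square)
  ultimately show thesis
    by (intro that[of ?B]) auto
qed

section \<open>Longest paths and longest cycles\<close>

lemma card_le_twice_card_doubletons:
  fixes R :: "('a \<times> 'a) set"
  assumes "finite R"
  shows "card R \<le> 2 * card ((\<lambda>(x, y). {x, y}) ` R)"
proof -
  let ?B = "(\<lambda>(x, y). {x, y}) ` R"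
  define D where "D = (\<lambda>e. {(x :: 'a, y). {x, y} = e})"
  have D: "finite (D e)" "card (D e) \<le> 2" if e: "e \<in> ?B" for e
  proof -
    obtain a b where "e = {a, b}" using e by auto
    then have D_e: "D e = set [(a, b), (b, a)]"
      by (auto simp: D_def doubleton_eq_iff)
    show "finite (D e)" unfolding D_e by (rule finite_set)
    show "card (D e) \<le> 2" unfolding D_e by (rule order.trans[OF card_length]) simp
  qed
  have "R \<subseteq> (\<Union>e\<in>?B. D e)" by (auto simp: D_def)
  then have "card R \<le> card (\<Union>e\<in>?B. D e)"
    using assms D(1) by (intro card_mono) blast+
  also have "\<dots> \<le> (\<Sum>e\<in>?B. card (D e))"
    using assms by (intro card_UN_le) auto
  also have "\<dots> \<le> (\<Sum>e\<in>?B. 2)"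
    using D(2) by (intro sum_mono) blast
  finally show ?thesis by simp
qed

text \<open>Every path on the vertex set of a longest path is itself longest, so the neighbours of
  its ends stay inside. Rotating one end and then the other gives at least \<open>d * d\<close>
  ordered pairs of ends, hence half as many edges.\<close>

lemma cycle_closing_edges:
  assumes E: "simple_graph V E" and deg: "\<forall>v\<in>V. d \<le> card (neighbours E v)"
    and "V \<noteq> {}" and d: "d \<ge> 2" and conn: "graph_connected V E"
    and nocyc: "\<nexists>vs. graph_cycle E vs \<and> min (card V) (2 * d) \<le> length vs"
  obtains B where "B \<subseteq> nsets V 2 - E" "d\<^sup>2 \<le> 2 * card B"
    "\<And>e. e \<in> B \<Longrightarrow> \<exists>vs. graph_cycle (insert e E) vs \<and> min (card V) (2 * d) \<le> length vs"
proof -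
  have finV: "finite V" using E by (simp add: simple_graph_def)
  define \<P> where "\<P> = (\<lambda>vs. graph_path E vs \<and> set vs \<subseteq> V)"
  have "length vs \<le> card V" if "\<P> vs" for vs
    using that finV card_mono[of V "set vs"] by (auto simp: \<P>_def graph_path_def distinct_card)
  moreover obtain v where "v \<in> V" using \<open>V \<noteq> {}\<close> by blast
  then have v: "\<P> [v]" by (simp add: \<P>_def)
  ultimately have "\<exists>P. \<P> P \<and> (\<forall>Q. \<P> Q \<longrightarrow> length Q \<le> length P)"
    by (intro ex_has_greatest_nat[of _ "[v]" _ "Suc (card V)"]) (simp_all add: less_Suc_eq_le)
  then obtain P where P: "\<P> P" and max: "\<And>Q. \<P> Q \<Longrightarrow> length Q \<le> length P"
    by blast
  have ne: "P \<noteq> []" using max[OF v] by auto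
  have same_length: "length Q = length P" if "graph_path E Q" "set Q = set P" for Q
    using that P length_graph_path_eq unfolding \<P>_def by blast
  have last: "neighbours E (last Q) \<subseteq> set Q" if Q: "graph_path E Q" "set Q = set P" for Q
  proof (rule ccontr)
    assume "\<not> neighbours E (last Q) \<subseteq> set Q"
    then obtain u where u: "u \<notin> set Q" "u \<in> neighbours E (last Q)" by auto
    then have "u \<in> V" using neighbours_subset[OF E] by blast
    then have "\<P> (Q @ [u])"
      using Q u P by (auto simp: \<P>_def graph_path_append neighbours_def insert_commute)
    then show False using max same_length[OF Q] by fastforce
  qed
  have card_succs_ge: "d \<le> card (succs E (last Q) Q)" if Q: "graph_path E Q" "set Q = set P" for Q
  proof -
    have "Q \<noteq> []" using Q ne by auto
    then have "last Q \<in> V" using Q P last_in_set by (fastforce simp: \<P>_def)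
    then show ?thesis
      using deg card_succs_last[OF E Q(1) \<open>Q \<noteq> []\<close> last[OF Q]] by simp
  qed
  have path: "graph_path E P" and sub: "set P \<subseteq> V" using P by (auto simp: \<P>_def)
  have last_P: "neighbours E (last P) \<subseteq> set P" using last[OF path] by simp
  have hd_P: "neighbours E (hd P) \<subseteq> set P"
    using last[of "rev P"] path by (simp add: last_rev)
  have ends: "hd P \<in> V" "last P \<in> V" using sub ne by auto
  have "card (neighbours E (last P)) \<le> card (set P - {last P})"
    using last_P neighbours_subset[OF E, of "last P"] by (intro card_mono) auto
  then have len3: "length P \<ge> 3"
    using d deg ends(2) ne path by (force simp: distinct_card graph_path_def)
  \<comment> \<open>A shorter longest path would close to a cycle on its own vertices. Connectivity
    supplies an edge leaving that cycle, hence a longer path.\<close>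
  have len: "min (card V) (2 * d) \<le> length P"
  proof (rule ccontr)
    assume short: "\<not> min (card V) (2 * d) \<le> length P"
    moreover have "2 * d \<le> card (neighbours E (hd P)) + card (neighbours E (last P))"
      using deg[rule_format, OF ends(1)] deg[rule_format, OF ends(2)] by simp
    ultimately obtain ws where ws: "graph_cycle E ws" "set ws = set P"
      using graph_cycle_through_path[OF E path len3 hd_P last_P] by force
    have "set P \<noteq> V"
      using short path distinct_card[of P] by (auto simp: graph_path_def)
    then obtain x y where xy: "x \<in> set P" "y \<in> V - set P" "{x, y} \<in> E"
      using conn sub ne unfolding graph_connected_def by (metis set_empty)
    then obtain Q where Q: "graph_path E Q" "length Q = Suc (length ws)" "set Q = insert y (set ws)"
      using graph_path_extend_cycle[OF ws(1), of x y] ws(2) by auto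
    moreover have "length ws = length P"
      using ws same_length by (auto simp: graph_cycle_iff_path)
    moreover have "\<P> Q" using Q ws xy sub by (auto simp: \<P>_def)
    ultimately show False using max by fastforce
  qed
  \<comment> \<open>A pair of ends that is already an edge would close a long cycle, against
    \<open>nocyc\<close>; so all these pairs are absent edges.\<close>
  define R where "R = {(hd Q, last Q) | Q. graph_path E Q \<and> set Q = set P}"
  have closes: "\<exists>vs. graph_cycle F vs \<and> min (card V) (2 * d) \<le> length vs"
    if "(x, y) \<in> R" "{x, y} \<in> F" "E \<subseteq> F" for x y F
  proof -
    obtain Q where Q: "graph_path E Q" "set Q = set P" "x = hd Q" "y = last Q"
      using \<open>(x, y) \<in> R\<close> by (auto simp: R_def)
    then have "graph_cycle F Q"
      using that(2,3) len3 same_length[OF Q(1,2)]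
      by (auto simp: graph_cycle_iff_path insert_commute intro: graph_path_mono)
    then show ?thesis using len same_length[OF Q(1,2)] by auto
  qed
  have R_V: "x \<in> V \<and> y \<in> V \<and> x \<noteq> y" if xy: "(x, y) \<in> R" for x y
  proof -
    obtain Q where Q: "graph_path E Q" "set Q = set P" "x = hd Q" "y = last Q"
      using xy by (auto simp: R_def)
    then have "length Q \<ge> 3" using len3 same_length by simp
    then obtain a b zs where "Q = a # b # zs" by (metis Suc_le_length_iff numeral_3_eq_3)
    then show ?thesis
      using Q sub by (auto simp: graph_path_def)
  qed
  have "R \<subseteq> V \<times> V" using R_V by auto
  then have finR: "finite R" using finV by (simp add: finite_subset)
  let ?A = "succs E (last P) P"
  \<comment> \<open>Reversal moves the new end \<open>b\<close> to the front, so that the second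
    rotation acts on the other end and keeps \<open>b\<close>.\<close>
  have "\<exists>Q. graph_path E Q \<and> set Q = set P \<and> hd Q = b \<and> last Q = hd P" if "b \<in> ?A" for b
  proof -
    obtain Q where "graph_path E Q" "set Q = set P" "hd Q = hd P" "last Q = b"
      using graph_path_rotate_end[OF path \<open>b \<in> ?A\<close>] .
    then show ?thesis
      by (intro exI[of _ "rev Q"]) (auto simp: hd_rev last_rev)
  qed
  then obtain q where q: "\<And>b. b \<in> ?A \<Longrightarrow> graph_path E (q b) \<and> set (q b) = set P \<and> hd (q b) = b"
    by metis
  have sub_R: "(SIGMA b:?A. succs E (last (q b)) (q b)) \<subseteq> R"
  proof clarify
    fix b c assume bc: "b \<in> ?A" "c \<in> succs E (last (q b)) (q b)"
    obtain Q where "graph_path E Q" "set Q = set (q b)" "hd Q = hd (q b)" "last Q = c"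
      using graph_path_rotate_end[OF _ bc(2)] q[OF bc(1)] by blast
    then show "(b, c) \<in> R" using q[OF bc(1)] by (force simp: R_def)
  qed
  have "d * d \<le> card ?A * d" using card_succs_ge[OF path] by simp
  also have "\<dots> = (\<Sum>b\<in>?A. d)" by simp
  also have "\<dots> \<le> (\<Sum>b\<in>?A. card (succs E (last (q b)) (q b)))"
    using q card_succs_ge by (intro sum_mono) blast
  also have "\<dots> = card (SIGMA b:?A. succs E (last (q b)) (q b))"
    by (simp add: finite_succs)
  also have "\<dots> \<le> card R"
    using sub_R finR by (rule card_mono[rotated])
  also have "\<dots> \<le> 2 * card ((\<lambda>(x, y). {x, y}) ` R)"
    using finR by (rule card_le_twice_card_doubletons)
  finally have "d\<^sup>2 \<le> 2 * card ((\<lambda>(x, y). {x, y}) ` R)"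
    by (simp add: power2_eq_square)
  moreover have "(\<lambda>(x, y). {x, y}) ` R \<subseteq> nsets V 2 - E"
    using R_V closes[of _ _ E] nocyc by auto
  moreover have "\<exists>vs. graph_cycle (insert e E) vs \<and> min (card V) (2 * d) \<le> length vs"
    if "e \<in> (\<lambda>(x, y). {x, y}) ` R" for e
    using that closes[of _ _ "insert e E"] by auto
  ultimately show thesis by (intro that)
qed

text \<open>For a vertex \<open>v\<close> off the cycle, an edge between two successors of its
  neighbours lets the cycle absorb \<open>v\<close>. By maximality no such edge is present yet, so
  all these pairs make progress.\<close>

lemma cycle_extending_edges:
  assumes E: "simple_graph V E" and deg: "\<forall>v\<in>V. d \<le> card (neighbours E v)"
    and cyc: "graph_cycle E vs" "card V = length vs + Suc k"
    and nocyc: "\<nexists>ws. graph_cycle E ws \<and> length vs < length ws"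
  obtains B where "B \<subseteq> nsets V 2 - E" "(d - Suc k) choose 2 \<le> card B"
    "\<And>e. e \<in> B \<Longrightarrow> \<exists>ws. graph_cycle (insert e E) ws \<and> length vs < length ws"
proof -
  have finV: "finite V" using E by (simp add: simple_graph_def)
  have sub: "set vs \<subseteq> V" and dist: "distinct vs" and ne: "vs \<noteq> []"
    using set_graph_cycle_subset[OF E cyc(1)] cyc(1) by (auto simp: graph_cycle_def)
  have card_out: "card (V - set vs) = Suc k"
    using sub finV cyc(2) dist by (simp add: card_Diff_subset distinct_card)
  then obtain v where v: "v \<in> V" "v \<notin> set vs"
    by (metis Diff_iff card.empty equals0I nat.distinct(1))
  let ?S = "succs E v vs"
  \<comment> \<open>Neighbours of \<open>v\<close> without a counted successor are
    \<open>last vs\<close> and the at most \<open>k\<close> other vertices off the cycle: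
    \<open>Suc k\<close> in total.\<close>
  have "neighbours E v \<subseteq> (neighbours E v \<inter> set (butlast vs)) \<union> ({last vs} \<union> (V - set vs - {v}))"
  proof
    fix u assume u: "u \<in> neighbours E v"
    have "set vs = set (butlast vs) \<union> {last vs}"
      using append_butlast_last_id[OF ne] by (metis list.set(1,2) set_append)
    then show "u \<in> (neighbours E v \<inter> set (butlast vs)) \<union> ({last vs} \<union> (V - set vs - {v}))"
      using u neighbours_subset[OF E, of v] by auto
  qed
  then have "card (neighbours E v) \<le> card ((neighbours E v \<inter> set (butlast vs)) \<union> ({last vs} \<union> (V - set vs - {v})))"
    using finV by (intro card_mono) auto
  also have "\<dots> \<le> card ?S + card ({last vs} \<union> (V - set vs - {v}))"
    by (simp only: card_succs[OF dist] card_Un_le)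
  also have "card ({last vs} \<union> (V - set vs - {v})) \<le> card {last vs} + card (V - set vs - {v})"
    by (rule card_Un_le)
  also have "\<dots> = Suc k" using v card_out finV by simp
  finally have card_S: "d - Suc k \<le> card ?S" using deg v(1) by fastforce
  have ext: "\<exists>ws. graph_cycle (insert e E) ws \<and> length vs < length ws" if e: "e \<in> nsets ?S 2" for e
  proof -
    obtain x y where "e = {x, y}" "x \<in> ?S" "y \<in> ?S" "x \<noteq> y"
      using e by (rule nsets2_E)
    then show ?thesis
      using graph_cycle_insert_vertex[OF cyc(1) v(2), of x y] by (metis lessI)
  qed
  show thesis
  proof
    have "?S \<subseteq> V" using succs_subset_tl[of E v vs] sub by (meson list.set_sel(2) ne subset_iff)
    moreover have "e \<notin> E" if "e \<in> nsets ?S 2" for e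
      using ext[OF that] nocyc by (metis insert_absorb)
    ultimately show "nsets ?S 2 \<subseteq> nsets V 2 - E"
      using nsets_mono[of ?S V 2] by blast
    show "(d - Suc k) choose 2 \<le> card (nsets ?S 2)"
      using card_S by (simp add: binomial_right_mono)
  qed (rule ext)
qed

section \<open>Exposing a random set element by element\<close>

text \<open>Count the pairs of a set \<open>S\<close> and an element \<open>e\<close> of it. In
  terms of exposure, the first element is uniform in \<open>X\<close>, and the rest is a uniform
  \<open>m\<close>-subset of what remains.\<close>

lemma card_nsets_Suc_double_count:
  assumes "finite X"
  shows "Suc m * card {S \<in> nsets X (Suc m). Q S} =
    (\<Sum>e\<in>X. card {S \<in> nsets (X - {e}) m. Q (insert e S)})"
proof -
  let ?A = "{S \<in> nsets X (Suc m). Q S}" and ?B = "\<lambda>e. {S \<in> nsets (X - {e}) m. Q (insert e S)}"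
  have fin: "finite ?A" "finite (?B e)" for e
    using assms by (simp_all add: finite_imp_finite_nsets)
  have "bij_betw (\<lambda>(S, e). (e, S - {e})) (SIGMA S:?A. S) (SIGMA e:X. ?B e)"
    by (rule bij_betw_byWitness[where f' = "\<lambda>(e, S). (insert e S, e)"])
       (auto simp: nsets_def insert_absorb card_insert_if subset_Diff_insert)
  then have "card (SIGMA S:?A. S) = card (SIGMA e:X. ?B e)"
    by (rule bij_betw_same_card)
  moreover have "card (SIGMA S:?A. S) = (\<Sum>S\<in>?A. card S)"
    using fin by (intro card_SigmaI) (auto simp: nsets_def)
  moreover have "(\<Sum>S\<in>?A. card S) = (\<Sum>S\<in>?A. Suc m)"
    by (intro sum.cong) (auto simp: nsets_def)
  moreover have "card (SIGMA e:X. ?B e) = (\<Sum>e\<in>X. card (?B e))"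
    using fin assms by (intro card_SigmaI) auto
  ultimately show ?thesis by (simp only: sum_constant of_nat_id mult.commute)
qed

text \<open>
  The factor \<open>1 - p + p s\<close> is the generating function of one Bernoulli trial, so the bound is Markov's
  inequality for \<open>s\<close> raised to the number of successes. Elements of \<open>U\<close> that already belong to \<open>G\<close>
  may or may not be in the remaining ground set \<open>X\<close>; progress is always made by elements outside \<open>G\<close>.
\<close>

lemma card_failing_nsets_le:
  fixes \<Phi> :: "nat \<Rightarrow> 'b set \<Rightarrow> bool" and p s :: real
  assumes U: "finite U" and s: "0 < s" "s \<le> 1" and p: "0 \<le> p" "p \<le> 1"
    and mono: "\<And>k G G'. \<Phi> k G \<Longrightarrow> G \<subseteq> G' \<Longrightarrow> \<Phi> k G'"
    and step: "\<And>k G. H \<subseteq> G \<Longrightarrow> G \<subseteq> U \<Longrightarrow> \<Phi> (Suc k) G \<Longrightarrow> \<not> \<Phi> k G \<Longrightarrow>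
      \<exists>B\<subseteq>U - G. p * card U \<le> card B \<and> (\<forall>e\<in>B. \<Phi> k (insert e G))"
  shows "\<Phi> k G \<Longrightarrow> H \<subseteq> G \<Longrightarrow> G \<subseteq> U \<Longrightarrow> U - G \<subseteq> X \<Longrightarrow> X \<subseteq> U \<Longrightarrow>
    card {S \<in> nsets X m. \<not> \<Phi> 0 (G \<union> S)} \<le> (card X choose m) * ((1 - p + p * s) ^ m / s ^ k)"
proof (induction m arbitrary: k G X)
  case 0
  have "card {S \<in> nsets X 0. \<not> \<Phi> 0 (G \<union> S)} \<le> card {{} :: 'b set}"
    by (intro card_mono) auto
  moreover have "1 \<le> 1 / s ^ k" using s by (simp add: power_le_one)
  ultimately show ?case by simp
next
  case (Suc m)
  let ?a = "1 - p + p * s"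
  have "p * s \<ge> 0" using p s by simp
  then have a: "?a \<ge> 0" using p by linarith
  from Suc.prems show ?case
  \<comment> \<open>The inner induction covers the case that \<open>\<Phi> k G\<close> already
    holds: the level then drops without an element being exposed.\<close>
  proof (induction k)
    case 0
    then have none: "{S \<in> nsets X (Suc m). \<not> \<Phi> 0 (G \<union> S)} = {}"
      using mono by blast
    show ?case unfolding none using a by simp
  next
    case (Suc k)
    note IH = \<open>\<And>k G X. \<Phi> k G \<Longrightarrow> H \<subseteq> G \<Longrightarrow> G \<subseteq> U \<Longrightarrow> U - G \<subseteq> X \<Longrightarrow> X \<subseteq> U \<Longrightarrow>
      card {S \<in> nsets X m. \<not> \<Phi> 0 (G \<union> S)} \<le> (card X choose m) * (?a ^ m / s ^ k)\<close>
    have finX: "finite X" using Suc.prems U finite_subset by blast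
    show ?case
    proof (cases "\<Phi> k G")
      case True
      then have "card {S \<in> nsets X (Suc m). \<not> \<Phi> 0 (G \<union> S)} \<le> (card X choose Suc m) * (?a ^ Suc m / s ^ k)"
        using Suc by blast
      also have "\<dots> \<le> (card X choose Suc m) * (?a ^ Suc m / s ^ Suc k)"
        using s a by (intro mult_left_mono divide_left_mono) (auto simp: mult_le_cancel_right1)
      finally show ?thesis .
    next
      case False
      then obtain B where B: "B \<subseteq> U - G" "p * card U \<le> card B" "\<forall>e\<in>B. \<Phi> k (insert e G)"
        using step[OF Suc.prems(2,3,1)] by blast
      have BX: "B \<subseteq> X" using B(1) Suc.prems by blast
      then have finB: "finite B" using finX finite_subset by blast
      define c where "c = (card X - 1 choose m) * (?a ^ m / s ^ Suc k)"
      have c0: "c \<ge> 0" using a s by (simp add: c_def)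
      let ?f = "\<lambda>e. card {S \<in> nsets (X - {e}) m. \<not> \<Phi> 0 (G \<union> insert e S)}"
      \<comment> \<open>Condition on the first exposed element \<open>e\<close>, which enters
        \<open>G\<close> and leaves the ground set.\<close>
      have f_le: "real (?f e) \<le> (card X - 1 choose m) * (?a ^ m / s ^ j)"
        if "e \<in> X" "\<Phi> j (insert e G)" for e j
      proof -
        have "card {S \<in> nsets (X - {e}) m. \<not> \<Phi> 0 (insert e G \<union> S)}
            \<le> (card (X - {e}) choose m) * (?a ^ m / s ^ j)"
          using that Suc.prems by (intro IH) auto
        then show ?thesis using that(1) by simp
      qed
      \<comment> \<open>On \<open>B\<close> the level falls to \<open>k\<close>, which gains a
        factor \<open>s\<close>; elsewhere monotonicity keeps the level
        \<open>Suc k\<close>.\<close>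
      have 1: "real (?f e) \<le> c * s" if "e \<in> B" for e
        using f_le[of e k] that B(3) BX s by (auto simp: c_def)
      have 2: "real (?f e) \<le> c" if "e \<in> X" for e
        using f_le[of e "Suc k"] that mono[OF \<open>\<Phi> (Suc k) G\<close>, of "insert e G"] by (auto simp: c_def)
      have "Suc m * card {S \<in> nsets X (Suc m). \<not> \<Phi> 0 (G \<union> S)} = (\<Sum>e\<in>X. ?f e)"
        by (rule card_nsets_Suc_double_count[OF finX])
      then have "Suc m * real (card {S \<in> nsets X (Suc m). \<not> \<Phi> 0 (G \<union> S)}) = (\<Sum>e\<in>X. real (?f e))"
        by (simp only: flip: of_nat_mult of_nat_sum)
      also have "\<dots> = (\<Sum>e\<in>B. real (?f e)) + (\<Sum>e\<in>X - B. real (?f e))"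
        using finX BX by (simp add: sum.subset_diff)
      also have "\<dots> \<le> (\<Sum>e\<in>B. c * s) + (\<Sum>e\<in>X - B. c)"
        using 1 2 by (intro add_mono sum_mono) auto
      also have "\<dots> = c * (card X - (1 - s) * card B)"
        using BX finX finB by (simp add: card_Diff_subset card_mono of_nat_diff algebra_simps)
      also have "\<dots> \<le> c * (card X - (1 - s) * (p * card X))"
      proof -
        \<comment> \<open>The proportion is guaranteed relative to \<open>U\<close>; as
          \<open>B\<close> lies in the possibly smaller \<open>X\<close>, it is at least
          \<open>p\<close> there too.\<close>
        have "p * card X \<le> p * card U"
          using p U Suc.prems by (intro mult_left_mono) (auto intro: card_mono)
        then have "p * card X \<le> card B" using B(2) by linarith
        then show ?thesis using c0 s by (intro mult_left_mono diff_mono) auto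
      qed
      also have "\<dots> = card X * c * ?a" by (simp add: algebra_simps)
      also have "\<dots> = (card X * (card X - 1 choose m)) * (?a ^ Suc m / s ^ Suc k)"
        by (simp add: c_def)
      also have "real (card X * (card X - 1 choose m)) = Suc m * (card X choose Suc m)"
        by (metis binomial_absorption)
      finally have "Suc m * real (card {S \<in> nsets X (Suc m). \<not> \<Phi> 0 (G \<union> S)})
          \<le> Suc m * ((card X choose Suc m) * (?a ^ Suc m / s ^ Suc k))"
        by (simp only: of_nat_mult mult.assoc)
      then show ?thesis by (simp only: mult_le_cancel_left_pos of_nat_0_less_iff zero_less_Suc)
    qed
  qed
qed

section \<open>Failure probability\<close>

lemma real_choose_two: "real (n choose 2) = real n * (real n - 1) / 2"
  by (cases n) (simp_all add: choose_two real_of_nat_div algebra_simps)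

lemma hamiltonian_iff_long_cycle:
  assumes "simple_graph V E"
  shows "hamiltonian V E \<longleftrightarrow> (\<exists>vs. graph_cycle E vs \<and> card V \<le> length vs)"
proof
  assume "hamiltonian V E"
  then obtain vs where "graph_cycle E vs" "set vs = V" by (auto simp: hamiltonian_def)
  then show "\<exists>vs. graph_cycle E vs \<and> card V \<le> length vs"
    using card_length[of vs] by auto
next
  assume "\<exists>vs. graph_cycle E vs \<and> card V \<le> length vs"
  then obtain vs where vs: "graph_cycle E vs" "card V \<le> length vs" by blast
  then have "set vs \<subseteq> V" "card V \<le> card (set vs)"
    using set_graph_cycle_subset[OF assms] by (auto simp: graph_cycle_def distinct_card)
  then have "set vs = V"
    using assms by (intro card_seteq) (auto simp: simple_graph_def)
  then show "hamiltonian V E" using vs by (auto simp: hamiltonian_def)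
qed

text \<open>
  \<open>deficit_le V d k E\<close> means that \<open>k\<close> further successful edges suffice for a Hamilton cycle; in
  particular, \<open>deficit_le V d 0 E\<close> is Hamiltonicity.
\<close>

definition deficit_le :: "'a set \<Rightarrow> nat \<Rightarrow> nat \<Rightarrow> 'a set set \<Rightarrow> bool" where
  "deficit_le V d k E \<longleftrightarrow>
     (if k \<le> card V - 2 * d then \<exists>vs. graph_cycle E vs \<and> card V - k \<le> length vs
      else if k = Suc (card V - 2 * d) then graph_connected V E else True)"

lemma graph_connected_mono:
  assumes "graph_connected V E" "E \<subseteq> F"
  shows "graph_connected V F"
  using assms unfolding graph_connected_def by (meson subsetD)

lemma deficit_le_mono:
  assumes "deficit_le V d k E" "E \<subseteq> F"
  shows "deficit_le V d k F"
proof (cases "k \<le> card V - 2 * d")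
  case True
  then show ?thesis
    using assms graph_cycle_mono[of E _ F] unfolding deficit_le_def by auto
next
  case False
  then show ?thesis
    using assms graph_connected_mono[of V E F] by (simp add: deficit_le_def)
qed

text \<open>Each kind of progress has at least about \<open>n\<^sup>2 / 8\<close> edges, up to an
  error of order \<open>\<eta> * n\<close> that the term \<open>8 * \<eta> / n\<close> pays for. As
  \<eta> is at least 1/2, that term also absorbs errors linear in \<open>n\<close>.\<close>

lemma many_deficit_reducing_edges:
  fixes \<eta> :: real
  assumes E: "simple_graph V E" and deg: "\<forall>v\<in>V. d \<le> card (neighbours E v)"
    and d: "real (card V) / 2 - \<eta> \<le> d" and \<eta>: "1 / 2 \<le> \<eta>" "\<eta> \<le> card V / 64"
    and k: "deficit_le V d (Suc k) E" "\<not> deficit_le V d k E"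
  shows "\<exists>B\<subseteq>nsets V 2 - E. (1 / 4 - 8 * \<eta> / card V) * (card V choose 2) \<le> card B \<and>
    (\<forall>e\<in>B. deficit_le V d k (insert e E))"
proof -
  define n where "n = real (card V)"
  have n: "n \<ge> 32" "\<eta> \<le> n / 64" "n / 2 - \<eta> \<le> d" using \<eta> d by (auto simp: n_def)
  have target: "(1 / 4 - 8 * \<eta> / card V) * (card V choose 2) = (n - 32 * \<eta>) * (n - 1) / 8"
    using n(1) by (simp add: real_choose_two flip: n_def) (simp add: field_simps)
  have le: "(n - 32 * \<eta>) * (n - 1) / 8 \<le> (n\<^sup>2 - 4 * \<eta> * n) / 8"
  proof -
    have "\<eta> * 32 \<le> \<eta> * n" using n(1) \<eta>(1) by (intro mult_left_mono) auto
    moreover have "\<eta> * n \<ge> 0" using n(1) \<eta>(1) by simp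
    ultimately show ?thesis using n(1) by (simp add: field_simps power2_eq_square)
  qed
  have d_sq: "(n\<^sup>2 - 4 * \<eta> * n) / 4 \<le> (real d)\<^sup>2"
  proof -
    have "(n / 2 - \<eta>)\<^sup>2 \<le> (real d)\<^sup>2" using n \<eta> by (intro power_mono) auto
    moreover have "(n\<^sup>2 - 4 * \<eta> * n) / 4 \<le> (n / 2 - \<eta>)\<^sup>2" by (simp add: power2_eq_square field_simps)
    ultimately show ?thesis by linarith
  qed
  consider "k < card V - 2 * d" | "k = card V - 2 * d" | "k = Suc (card V - 2 * d)"
    using k(2) by (force simp: deficit_le_def)
  then show ?thesis
  proof cases
    case 1
    then obtain vs where vs: "graph_cycle E vs" "card V - Suc k \<le> length vs"
      using k(1) by (auto simp: deficit_le_def)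
    have no: "\<nexists>ws. graph_cycle E ws \<and> card V - k \<le> length ws"
      using k(2) 1 by (auto simp: deficit_le_def)
    then have len: "card V = length vs + Suc k" using vs 1 by force
    then have long: "card V - k \<le> j \<longleftrightarrow> length vs < j" for j by auto
    obtain B where B: "B \<subseteq> nsets V 2 - E" "(d - Suc k) choose 2 \<le> card B"
      "\<And>e. e \<in> B \<Longrightarrow> \<exists>ws. graph_cycle (insert e E) ws \<and> length vs < length ws"
      using cycle_extending_edges[OF E deg vs(1) len] no unfolding long by blast
    define t where "t = real (d - Suc k)"
    \<comment> \<open>This gives \<open>d - Suc k\<close> at least \<open>3 * d - n\<close>, hence
      at least \<open>n / 2 - 3 * \<eta>\<close>.\<close>
    have "real (Suc k) \<le> n - 2 * d" using 1 by (simp add: n_def)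
    then have "n / 2 - 3 * \<eta> \<le> t" using n \<eta> by (simp add: t_def)
    then have t: "(n / 2 - 3 * \<eta>) * (n / 2 - 3 * \<eta> - 1) \<le> t * (t - 1)"
      using n \<eta> by (intro mult_mono) auto
    \<comment> \<open>Naming the products makes the remaining inequality linear:
      \<open>20 * q\<close> is at least \<open>10 * n\<close>, which dominates
      \<open>n + 20 * \<eta>\<close>.\<close>
    define q r where "q = \<eta> * n" and "r = \<eta> * \<eta>"
    have "n / 2 \<le> q" using n(1) \<eta>(1) mult_right_mono[of "1 / 2" \<eta> n] by (simp add: q_def)
    moreover have "0 \<le> r" by (simp add: r_def)
    moreover have "20 * \<eta> \<le> n" using n(2) \<eta>(1) by simp
    ultimately have "0 \<le> (20 * q + 36 * r - n - 20 * \<eta>) / 8"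
      using n(1) by simp
    also have "\<dots> = (n / 2 - 3 * \<eta>) * (n / 2 - 3 * \<eta> - 1) / 2 - (n - 32 * \<eta>) * (n - 1) / 8"
      by (simp add: field_simps q_def r_def)
    finally have "(n - 32 * \<eta>) * (n - 1) / 8 \<le> (n / 2 - 3 * \<eta>) * (n / 2 - 3 * \<eta> - 1) / 2"
      by (simp only: diff_ge_0_iff_ge)
    also have "\<dots> \<le> t * (t - 1) / 2" using t by simp
    also have "\<dots> = real ((d - Suc k) choose 2)" by (simp add: real_choose_two t_def)
    also have "\<dots> \<le> card B" using B(2) by simp
    finally show ?thesis
      using B(1,3) 1 unfolding target by (intro exI[of _ B]) (auto simp: deficit_le_def long)
  next
    case 2
    \<comment> \<open>Subtraction truncates: if \<open>2 * d\<close> exceeds \<open>card V\<close>,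
      the required cycle passes through all vertices.\<close>
    have min: "card V - (card V - 2 * d) = min (card V) (2 * d)" by simp
    have "V \<noteq> {}" "d \<ge> 2" using n \<eta> by (auto simp: n_def)
    then obtain B where B: "B \<subseteq> nsets V 2 - E" "d\<^sup>2 \<le> 2 * card B"
      "\<And>e. e \<in> B \<Longrightarrow> \<exists>vs. graph_cycle (insert e E) vs \<and> min (card V) (2 * d) \<le> length vs"
      using cycle_closing_edges[OF E deg] k unfolding 2 deficit_le_def min by auto
    have "real (d\<^sup>2) \<le> real (2 * card B)" using B(2) of_nat_le_iff by blast
    then have "(n - 32 * \<eta>) * (n - 1) / 8 \<le> card B" using le d_sq by simp
    then show ?thesis
      using B(1,3) unfolding target 2 deficit_le_def min by (intro exI[of _ B]) auto
  next
    case 3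
    have "card V < 3 * (d + 1)" using n \<eta> by (simp add: n_def flip: of_nat_less_iff[where 'a = real])
    then obtain B where B: "B \<subseteq> nsets V 2 - E" "(d + 1)\<^sup>2 \<le> card B"
      "\<And>e. e \<in> B \<Longrightarrow> graph_connected V (insert e E)"
      using connecting_edges[OF E deg] k(2) 3 by (auto simp: deficit_le_def)
    have "real ((d + 1)\<^sup>2) \<le> real (card B)" using B(2) of_nat_le_iff by blast
    moreover have "(real d)\<^sup>2 \<le> real ((d + 1)\<^sup>2)" by (simp add: power_mono)
    moreover have "0 \<le> (real d)\<^sup>2" by simp
    moreover have "0 \<le> n\<^sup>2 - 4 * \<eta> * n" using n by (simp add: power2_eq_square mult_right_mono)
    ultimately have "(n - 32 * \<eta>) * (n - 1) / 8 \<le> card B" using le d_sq by linarith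
    then show ?thesis
      using B(1,3) 3 unfolding target by (intro exI[of _ B]) (auto simp: deficit_le_def)
  qed
qed

text \<open>A Chernoff bound for the lower tail, with \<open>y\<close> as the mean number of
  successes. The starting level \<open>card V - 2 * d' + 2\<close> holds for every graph and is at
  most \<open>K\<close>.\<close>

lemma prob_not_hamiltonian_le:
  fixes \<eta> :: real
  assumes H: "simple_graph V H" and d: "real (card V) / 2 - \<eta> \<le> min_degree V H"
    and \<eta>: "1 / 2 \<le> \<eta>" "\<eta> \<le> card V / 64" and m: "m \<le> card V choose 2"
    and y: "y = (1 / 4 - 8 * \<eta> / card V) * m" "2 * \<eta> + 2 \<le> y"
  shows "measure_pmf.prob (Gnm V m) {G. \<not> hamiltonian V (H \<union> G)}
    \<le> exp (- ((y - (2 * \<eta> + 2))\<^sup>2 / (4 * y)))"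
proof -
  define p where "p = 1 / 4 - 8 * \<eta> / card V"
  define K where "K = 2 * \<eta> + 2"
  \<comment> \<open>This \<open>x\<close> minimises the exponent
    \<open>x * K - y * (x - x\<^sup>2)\<close> reached below; the form of \<open>s\<close> gives
    \<open>1 / s ^ k = (1 + x) ^ k\<close> and bounds \<open>1 - s\<close> below by
    \<open>x - x\<^sup>2\<close>.\<close>
  define x where "x = (y - K) / (2 * y)"
  define s where "s = 1 / (1 + x)"
  define d' where "d' = min_degree V H"
  define k where "k = card V - 2 * d' + 2"
  have finV: "finite V" using H by (simp add: simple_graph_def)
  have n: "real (card V) \<ge> 32" using \<eta> by linarith
  then have "8 * \<eta> / card V \<le> 1 / 8" "8 * \<eta> / card V \<ge> 0" using \<eta> by (simp_all add: field_simps)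
  then have p: "1 / 8 \<le> p" "p \<le> 1 / 4" by (simp_all add: p_def)
  have y0: "y > 0" using y(2) \<eta> by linarith
  have x: "0 \<le> x" "x \<le> 1 / 2" using y0 y(2) \<eta> by (auto simp: x_def K_def field_simps)
  have s: "0 < s" "s \<le> 1" using x by (auto simp: s_def)
  have degH: "d' \<le> card (neighbours H v)" if "v \<in> V" for v
    using that finV by (simp add: d'_def min_degree_def flip: vertex_degree_eq_card_neighbours[OF H])
  have deg: "\<forall>v\<in>V. d' \<le> card (neighbours G v)" if "H \<subseteq> G" "simple_graph V G" for G
  proof
    fix v assume "v \<in> V"
    have "card (neighbours H v) \<le> card (neighbours G v)"
      using that by (intro card_mono finite_neighbours) (auto simp: neighbours_def)
    then show "d' \<le> card (neighbours G v)" using degH[OF \<open>v \<in> V\<close>] by simp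
  qed
  have HU: "H \<subseteq> nsets V 2" using H by (simp add: simple_graph_def)
  let ?bad = "{S \<in> nsets (nsets V 2) m. \<not> deficit_le V d' 0 (H \<union> S)}"
  have bad: "real (card ?bad) \<le> (card (nsets V 2) choose m) * ((1 - p + p * s) ^ m / s ^ k)"
  \<comment> \<open>The ground set is all pairs, so random edges may repeat edges of
    \<open>H\<close>; these never count as successes.\<close>
  proof (rule card_failing_nsets_le[where U = "nsets V 2" and H = H])
    fix k G assume G: "H \<subseteq> G" "G \<subseteq> nsets V 2" "deficit_le V d' (Suc k) G" "\<not> deficit_le V d' k G"
    then have "simple_graph V G" using finV by (simp add: simple_graph_def)
    then show "\<exists>B\<subseteq>nsets V 2 - G. p * card (nsets V 2) \<le> card B \<and> (\<forall>e\<in>B. deficit_le V d' k (insert e G))"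
      unfolding p_def card_nsets
      using G deg d \<eta> by (intro many_deficit_reducing_edges) (auto simp: d'_def)
  next
    show "deficit_le V d' k H" by (simp add: deficit_le_def k_def)
  qed (use finV p s HU deficit_le_mono in \<open>auto simp: finite_imp_finite_nsets\<close>)
  have graphs: "{G. simple_graph V G \<and> card G = m} = nsets (nsets V 2) m"
    using finV finite_imp_finite_nsets[OF finV, of 2]
    by (auto simp: simple_graph_def nsets_def[of "nsets V 2"] dest: finite_subset)
  have ham: "hamiltonian V (H \<union> G) \<longleftrightarrow> deficit_le V d' 0 (H \<union> G)" if "G \<in> nsets (nsets V 2) m" for G
  proof -
    have "simple_graph V (H \<union> G)"
      using that H by (auto simp: simple_graph_def nsets_def[of "nsets V 2"])
    then show ?thesis by (simp add: hamiltonian_iff_long_cycle deficit_le_def)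
  qed
  have fin: "finite (nsets (nsets V 2) m)" using finV by (intro finite_imp_finite_nsets)
  have pos: "(card V choose 2) choose m > 0" using m by simp
  then have "nsets (nsets V 2) m \<noteq> {}" by (metis card.empty card_nsets less_numeral_extra(3))
  then have "measure_pmf.prob (Gnm V m) {G. \<not> hamiltonian V (H \<union> G)}
      = card (nsets (nsets V 2) m \<inter> {G. \<not> hamiltonian V (H \<union> G)}) / card (nsets (nsets V 2) m)"
    unfolding Gnm_def graphs using fin by (rule measure_pmf_of_set)
  also have "nsets (nsets V 2) m \<inter> {G. \<not> hamiltonian V (H \<union> G)} = ?bad"
    using ham by auto
  also have "card ?bad / card (nsets (nsets V 2) m) \<le> (1 - p + p * s) ^ m / s ^ k"
    using bad pos by (simp add: field_simps)
  also have "\<dots> \<le> exp (x * K - y * (x - x\<^sup>2))"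
  proof -
    have "x - x\<^sup>2 \<le> 1 - s"
      using x by (simp add: s_def field_simps power2_eq_square)
    then have "1 - p + p * s \<le> 1 + - (p * (x - x\<^sup>2))"
      using p mult_left_mono[of "x - x\<^sup>2" "1 - s" p] by (simp add: algebra_simps)
    also have "\<dots> \<le> exp (- (p * (x - x\<^sup>2)))" by (rule exp_ge_add_one_self)
    finally have "(1 - p + p * s) ^ m \<le> exp (- (p * (x - x\<^sup>2))) ^ m"
      using p s by (intro power_mono) auto
    also have "\<dots> = exp (- (y * (x - x\<^sup>2)))"
      by (simp add: y(1) p_def flip: exp_of_nat_mult)
    finally have 1: "(1 - p + p * s) ^ m \<le> exp (- (y * (x - x\<^sup>2)))" .
    have "1 / s ^ k = (1 + x) ^ k" by (simp add: s_def power_divide)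
    also have "\<dots> \<le> exp x ^ k" using x by (intro power_mono) auto
    also have "\<dots> = exp (k * x)" by (simp flip: exp_of_nat_mult)
    also have "\<dots> \<le> exp (x * K)"
    proof -
      have "real k \<le> K" using d \<eta> by (auto simp: k_def K_def d'_def)
      then show ?thesis using x mult_left_mono[of "real k" K x] by (simp add: mult.commute)
    qed
    finally have "(1 - p + p * s) ^ m * (1 / s ^ k) \<le> exp (- (y * (x - x\<^sup>2))) * exp (x * K)"
      using 1 s by (intro mult_mono) auto
    then show ?thesis by (simp flip: exp_add)
  qed
  also have "x * K - y * (x - x\<^sup>2) = - ((y - K)\<^sup>2 / (4 * y))"
  proof -
    have yx: "y * x = (y - K) / 2" using y0 by (simp add: x_def)
    have "x * K - y * (x - x\<^sup>2) = - x * (y - K) + x * (y * x)"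
      by (simp add: algebra_simps power2_eq_square)
    also have "\<dots> = - x * ((y - K) / 2)" unfolding yx by (simp add: field_simps)
    also have "\<dots> = - ((y - K)\<^sup>2 / (4 * y))"
      using y0 by (simp add: x_def field_simps power2_eq_square)
    finally show ?thesis .
  qed
  finally show ?thesis by (simp add: K_def)
qed

section \<open>Asymptotics\<close>

lemma asymptotically_almost_surelyI_exp:
  assumes "\<And>T :: real. T > 0 \<Longrightarrow>
    \<forall>\<^sub>F n in sequentially. measure_pmf.prob (G n) {x. \<not> P n x} \<le> exp (- T)"
  shows "asymptotically_almost_surely G P"
proof -
  have "(\<lambda>n. measure_pmf.prob (G n) {x. \<not> P n x}) \<longlonglongrightarrow> 0"
  proof (rule tendstoI)
    fix \<epsilon> :: real assume "\<epsilon> > 0"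
    define T where "T = \<bar>ln (\<epsilon> / 2)\<bar> + 1"
    have "exp (- T) \<le> exp (ln (\<epsilon> / 2))" by (simp add: T_def)
    also have "\<dots> < \<epsilon>" using \<open>\<epsilon> > 0\<close> by simp
    finally have "exp (- T) < \<epsilon>" .
    moreover have "T > 0" by (simp add: T_def add_nonneg_pos)
    ultimately show "\<forall>\<^sub>F n in sequentially. dist (measure_pmf.prob (G n) {x. \<not> P n x}) 0 < \<epsilon>"
      using assms[of T] by (auto elim: eventually_mono)
  qed
  then have "(\<lambda>n. 1 - measure_pmf.prob (G n) {x. \<not> P n x}) \<longlonglongrightarrow> 1 - 0"
    by (intro tendsto_intros)
  moreover have "1 - measure_pmf.prob (G n) {x. \<not> P n x} = measure_pmf.prob (G n) {x. P n x}" for n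
    using measure_pmf.prob_neg[of "G n" "P n"] by simp
  ultimately show ?thesis by (simp add: asymptotically_almost_surely_def)
qed

text \<open>What is left for both regimes is that the Chernoff exponent eventually exceeds every
  constant \<open>T\<close>.\<close>

lemma aas_hamiltonian:
  fixes V :: "nat \<Rightarrow> 'a set" and \<eta> :: "nat \<Rightarrow> real"
  assumes "\<And>n. simple_graph (V n) (H n)" and "\<And>n. card (V n) = n"
    and "\<forall>\<^sub>F n in sequentially. real (min_degree (V n) (H n)) \<ge> real n / 2 - \<eta> n"
    and "\<forall>\<^sub>F n in sequentially. 1 / 2 \<le> \<eta> n \<and> \<eta> n \<le> real n / 64"
    and "\<forall>\<^sub>F n in sequentially. m n \<in> {1..n choose 2}"
    and "y = (\<lambda>n. (1 / 4 - 8 * \<eta> n / real n) * real (m n))"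
    and large: "\<And>T :: real. T > 0 \<Longrightarrow> \<forall>\<^sub>F n in sequentially.
      2 * \<eta> n + 2 \<le> y n \<and> T \<le> (y n - (2 * \<eta> n + 2))\<^sup>2 / (4 * y n)"
  shows "asymptotically_almost_surely (\<lambda>n. Gnm (V n) (m n)) (\<lambda>n G. hamiltonian (V n) (H n \<union> G))"
proof (rule asymptotically_almost_surelyI_exp)
  fix T :: real assume "T > 0"
  show "\<forall>\<^sub>F n in sequentially.
    measure_pmf.prob (Gnm (V n) (m n)) {G. \<not> hamiltonian (V n) (H n \<union> G)} \<le> exp (- T)"
    using assms(3-5) large[OF \<open>T > 0\<close>]
  proof eventually_elim
    case (elim n)
    then have "measure_pmf.prob (Gnm (V n) (m n)) {G. \<not> hamiltonian (V n) (H n \<union> G)}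
        \<le> exp (- ((y n - (2 * \<eta> n + 2))\<^sup>2 / (4 * y n)))"
      using assms(1,2,6) by (intro prob_not_hamiltonian_le) auto
    also have "\<dots> \<le> exp (- T)" using elim by simp
    finally show ?case .
  qed
qed

text \<open>For regime (a): \<open>y - K\<close> is at least \<open>y / 2\<close>, so the exponent
  is at least \<open>y / 16\<close>.\<close>

lemma deviation_ge_linear:
  fixes K y T :: real
  assumes "0 \<le> K" "2 * K \<le> y" "16 * T \<le> y" "0 < y"
  shows "T \<le> (y - K)\<^sup>2 / (4 * y)"
proof -
  have "(y / 2)\<^sup>2 \<le> (y - K)\<^sup>2" using assms by (intro power_mono) auto
  moreover have "16 * T * y \<le> y * y" using assms by (intro mult_right_mono) auto
  ultimately have "T * (4 * y) \<le> (y - K)\<^sup>2" by (simp add: power2_eq_square)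
  then show ?thesis using assms by (simp add: pos_le_divide_eq)
qed

text \<open>For regime (b), with \<open>z\<close> the excess of \<open>y\<close> over
  \<open>2 * \<eta>\<close>. The numerator is at least \<open>z\<^sup>2 / 4\<close>, and the last
  two assumptions bound \<open>4 * T * z\<close> and \<open>8 * T * \<eta>\<close> by
  \<open>z\<^sup>2 / 8\<close> each.\<close>

lemma deviation_ge_sqrt:
  fixes \<eta> z T :: real
  assumes "0 \<le> \<eta>" "4 \<le> z" "32 * T \<le> z" "64 * T * \<eta> \<le> z\<^sup>2"
  shows "T \<le> (z - 2)\<^sup>2 / (4 * (z + 2 * \<eta>))"
proof -
  have "(z / 2)\<^sup>2 \<le> (z - 2)\<^sup>2" using assms by (intro power_mono) auto
  moreover have "32 * T * z \<le> z\<^sup>2"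
    unfolding power2_eq_square using assms by (intro mult_right_mono) auto
  moreover have "(z / 2)\<^sup>2 = z\<^sup>2 / 4" by (simp add: power_divide)
  moreover have "T * (4 * (z + 2 * \<eta>)) = (32 * T * z) / 8 + (64 * T * \<eta>) / 8" by (simp add: algebra_simps)
  ultimately have "T * (4 * (z + 2 * \<eta>)) \<le> (z - 2)\<^sup>2" using assms(4) by linarith
  moreover have "0 < z + 2 * \<eta>" using assms by simp
  ultimately show ?thesis by (simp only: pos_le_divide_eq mult_pos_pos zero_less_numeral)
qed

theorem theorem2p1:
  fixes V :: "nat \<Rightarrow> 'a set" and H :: "nat \<Rightarrow> 'a set set"
    and \<eta> lam :: "nat \<Rightarrow> real" and m :: "nat \<Rightarrow> nat"
  assumes "\<And>n. simple_graph (V n) (H n)" and "\<And>n. card (V n) = n"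
    and "\<forall>\<^sub>F n in sequentially. real (min_degree (V n) (H n)) \<ge> real n / 2 - \<eta> n"
    and "\<forall>\<^sub>F n in sequentially. 1 / 2 \<le> \<eta> n \<and> \<eta> n \<le> real n / 64"
    and "\<forall>\<^sub>F n in sequentially. m n \<in> {1..n choose 2}"
  shows
    "((\<lambda>n. real (m n)) \<in> \<omega>(\<eta>) \<longrightarrow>
        asymptotically_almost_surely (\<lambda>n. Gnm (V n) (m n)) (\<lambda>n G. hamiltonian (V n) (H n \<union> G)))
     \<and>
     (\<eta> \<in> \<omega>(\<lambda>_. 1) \<and>
      lam \<in> \<omega>(\<lambda>n. \<eta> n powr (1 / 2)) \<and> (\<forall>\<^sub>F n in sequentially. lam n \<ge> 0) \<and>
      (\<forall>\<^sub>F n in sequentially. real (m n) \<ge> 2 * \<eta> n / (1 / 4 - 8 * \<eta> n / real n) + lam n) \<longrightarrow>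
        asymptotically_almost_surely (\<lambda>n. Gnm (V n) (m n)) (\<lambda>n G. hamiltonian (V n) (H n \<union> G)))"
proof (intro conjI impI; (elim conjE)?)
  define y where "y = (\<lambda>n. (1 / 4 - 8 * \<eta> n / real n) * real (m n))"
  note aas = aas_hamiltonian[OF assms y_def]
  have p_ge: "1 / 8 \<le> 1 / 4 - 8 * \<eta> n / real n" if "1 / 2 \<le> \<eta> n \<and> \<eta> n \<le> real n / 64" for n
  proof -
    have "real n > 0" using that by linarith
    then have "8 * \<eta> n / real n \<le> 1 / 8" using that by (simp add: field_simps)
    then show ?thesis by simp
  qed
  {
    assume m: "(\<lambda>n. real (m n)) \<in> \<omega>(\<eta>)"
    show "asymptotically_almost_surely (\<lambda>n. Gnm (V n) (m n)) (\<lambda>n G. hamiltonian (V n) (H n \<union> G))"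
    proof (rule aas)
      fix T :: real assume "T > 0"
      \<comment> \<open>After the factor 1/8 from \<open>p_ge\<close>, 96 leaves
        \<open>12 * \<eta> n\<close>, which is at least \<open>2 * (2 * \<eta> n + 2)\<close>, and
        \<open>256 * T\<close> leaves \<open>32 * T * \<eta> n\<close>, which is at least
        \<open>16 * T\<close>; both use that \<eta> is at least 1/2.\<close>
      then have "\<forall>\<^sub>F n in sequentially. norm (real (m n)) \<ge> (96 + 256 * T) * norm (\<eta> n)"
        by (intro landau_omega.smallD[OF m]) simp
      with assms(4) show "\<forall>\<^sub>F n in sequentially.
        2 * \<eta> n + 2 \<le> y n \<and> T \<le> (y n - (2 * \<eta> n + 2))\<^sup>2 / (4 * y n)"
      proof eventually_elim
        case (elim n)
        have "1 / 8 * real (m n) \<le> y n"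
          unfolding y_def using p_ge[OF elim(1)] by (intro mult_right_mono) auto
        moreover have "T * (1 / 2) \<le> T * \<eta> n" using elim \<open>T > 0\<close> by (intro mult_left_mono) auto
        moreover have "(96 + 256 * T) * \<eta> n \<le> real (m n)" using elim by simp
        ultimately have "12 * \<eta> n + 16 * T \<le> y n" by (simp add: algebra_simps)
        then show ?case
          using elim \<open>T > 0\<close> by (intro conjI deviation_ge_linear) auto
      qed
    qed
  next
    assume \<eta>: "\<eta> \<in> \<omega>(\<lambda>_. 1)" and lam: "lam \<in> \<omega>(\<lambda>n. \<eta> n powr (1 / 2))"
      "\<forall>\<^sub>F n in sequentially. lam n \<ge> 0"
      "\<forall>\<^sub>F n in sequentially. real (m n) \<ge> 2 * \<eta> n / (1 / 4 - 8 * \<eta> n / real n) + lam n"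
    show "asymptotically_almost_surely (\<lambda>n. Gnm (V n) (m n)) (\<lambda>n G. hamiltonian (V n) (H n \<union> G))"
    proof (rule aas)
      fix T :: real assume "T > 0"
      \<comment> \<open>\<open>M\<close> exceeds 4 and \<open>32 * T\<close>, and its square exceeds
        \<open>64 * T\<close>, as \<open>deviation_ge_sqrt\<close> needs. The factor 8 on
        \<open>M\<close> below offsets the success probability, which is at least 1/8.\<close>
      define M where "M = 64 * (T + 1)"
      have "M > 0" using \<open>T > 0\<close> by (simp add: M_def)
      have "\<forall>\<^sub>F n in sequentially. norm (\<eta> n) \<ge> 1 * norm (1 :: real)"
        by (intro landau_omega.smallD[OF \<eta>]) simp
      moreover have "\<forall>\<^sub>F n in sequentially. norm (lam n) \<ge> (8 * M) * norm (\<eta> n powr (1 / 2))"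
        using \<open>M > 0\<close> by (intro landau_omega.smallD[OF lam(1)]) simp
      ultimately show "\<forall>\<^sub>F n in sequentially.
        2 * \<eta> n + 2 \<le> y n \<and> T \<le> (y n - (2 * \<eta> n + 2))\<^sup>2 / (4 * y n)"
        using assms(4) lam(2,3)
      proof eventually_elim
        case (elim n)
        define p where "p = 1 / 4 - 8 * \<eta> n / real n"
        have p: "1 / 8 \<le> p" unfolding p_def using p_ge elim by blast
        have \<eta>1: "\<eta> n \<ge> 1" using elim by simp
        have lam_ge: "8 * M * sqrt (\<eta> n) \<le> lam n"
          using elim \<eta>1 by (simp add: powr_half_sqrt)
        \<comment> \<open>Multiplied by \<open>p\<close>, the threshold on \<open>m n\<close>
          becomes exactly \<open>2 * \<eta> n\<close> plus an excess of
          \<open>p * lam n\<close>.\<close>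
        have "2 * \<eta> n + p * lam n = p * (2 * \<eta> n / p + lam n)"
          using p by (simp add: distrib_left)
        also have "\<dots> \<le> y n"
          unfolding y_def using p elim by (auto simp flip: p_def intro!: mult_left_mono)
        finally have "p * lam n \<le> y n - 2 * \<eta> n" by simp
        moreover have "1 / 8 * lam n \<le> p * lam n"
          using p elim by (intro mult_right_mono) auto
        ultimately have z: "M * sqrt (\<eta> n) \<le> y n - 2 * \<eta> n" using lam_ge by simp
        have "M * 1 \<le> M * sqrt (\<eta> n)" using \<eta>1 \<open>M > 0\<close> by (intro mult_left_mono) auto
        then have zM: "M \<le> y n - 2 * \<eta> n" using z by simp
        have "64 * T \<le> M" "1 \<le> M" using \<open>T > 0\<close> by (simp_all add: M_def)
        then have "64 * T * 1 \<le> M * M" using \<open>T > 0\<close> by (intro mult_mono) auto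
        then have "64 * T * \<eta> n \<le> M * M * \<eta> n" using \<eta>1 by (intro mult_right_mono) auto
        also have "\<dots> = (M * sqrt (\<eta> n))\<^sup>2"
          using \<eta>1 by (simp add: power_mult_distrib power2_eq_square)
        also have "\<dots> \<le> (y n - 2 * \<eta> n)\<^sup>2"
          using z \<eta>1 \<open>M > 0\<close> by (intro power_mono) auto
        finally have "T \<le> (y n - 2 * \<eta> n - 2)\<^sup>2 / (4 * (y n - 2 * \<eta> n + 2 * \<eta> n))"
          using zM \<eta>1 \<open>T > 0\<close> by (intro deviation_ge_sqrt) (auto simp: M_def)
        then show ?case using zM \<open>T > 0\<close> by (simp add: M_def diff_diff_eq)
      qed
    qed
  }
qed

end
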